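(* Let $\mathcal{K}\subset\mathbb{R}^n$ be a proper subdual cone, let $\mathcal{C}=\mathbb{S}^{n-1}\cap\operatorname{int}(\mathcal{K})$, let $A=A^{\top}\in\mathbb{R}^{n\times n}$, and let $q_A:\mathcal{C}\to\mathbb{R}$, $q_A(x)=\langle Ax,x\rangle$. Then $q_A$ is spherically quasi-convex if and only if the cone $$\{x\in\mathcal{K}:\langle A_c x,x\rangle\le0\}$$ is convex for any $c\in\mathbb{R}$, where $A_c:=A-cI_n$.
   Context: $\langle\cdot,\cdot\rangle$ and $\|\cdot\|$ are the canonical inner product and norm on $\mathbb{R}^n$; $I_n$ is the identity matrix; $\mathbb{S}^{n-1}=\{x\in\mathbb{R}^n:\|x\|=1\}$ with intrinsic distance $d(x,y)=\arccos\langle x,y\rangle$. A cone is a set invariant under multiplication by positive scalars. A proper cone is a closed convex cone with nonempty interior which is pointed ($\mathcal{K}\cap(-\mathcal{K})\subseteq\{0\}$). The dual cone is $\mathcal{K}^*=\{x\in\mathbb{R}^n:\langle x,y\rangle\ge 0\ \forall y\in\mathcal{K}\}$, and $\mathcal{K}$ is subdual if $\mathcal{K}\subset\mathcal{K}^*$. A minimal geodesic segment is a constant-speed parametrized arc of a great circle whose length equals the distance $d$ between its endpoints. A set $\mathcal{C}\subseteq\mathbb{S}^{n-1}$ is spherically convex if for any $x,y\in\mathcal{C}$ all minimal geodesic segments joining $x$ to $y$ are contained in $\mathcal{C}$; the set $\mathcal{C}=\mathbb{S}^{n-1}\cap\operatorname{int}(\mathcal{K})$ is spherically convex. A function $f:\mathcal{C}\to\mathbb{R}$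 on a spherically convex set is spherically quasi-convex if for every minimal geodesic segment $\gamma:I\to\mathcal{C}$ ($I\subset\mathbb{R}$ an interval), $f(\gamma(t))\le\max\{f(\gamma(t_1)),f(\gamma(t_2))\}$ for all $t\in[t_1,t_2]\subset I$. *)

theory Defs
  imports "HOL-Analysis.Analysis"
begin

text \<open>
  Unlike the library's \<^const>\<open>cone\<close>, a cone is only required to be invariant under
  multiplication by strictly positive scalars.
\<close>

definition pos_cone :: "'a::real_vector set \<Rightarrow> bool" where
  "pos_cone K \<longleftrightarrow> (\<forall>x\<in>K. \<forall>c>0. c *\<^sub>R x \<in> K)"

definition proper_cone :: "'a::real_normed_vector set \<Rightarrow> bool" where
  "proper_cone K \<longleftrightarrow>
     pos_cone K \<and> closed K \<and> convex K \<and> interior K \<noteq> {} \<and> K \<inter> uminus ` K \<subseteq> {0}"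

definition dual_cone :: "'a::real_inner set \<Rightarrow> 'a set" where
  "dual_cone K = {x. \<forall>y\<in>K. 0 \<le> x \<bullet> y}"

definition subdual :: "'a::real_inner set \<Rightarrow> bool" where
  "subdual K \<longleftrightarrow> K \<subseteq> dual_cone K"

definition sphere_dist :: "'a::real_inner \<Rightarrow> 'a \<Rightarrow> real" where
  "sphere_dist x y = arccos (x \<bullet> y)"

text \<open>
  The curve \<open>\<gamma>\<close> on \<open>[a, b]\<close> runs with constant speed \<open>v\<close> along the great circle spanned by
  the orthonormal pair \<open>p\<close>, \<open>w\<close>, starting at \<open>p\<close>; hence its length is \<open>v * (b - a)\<close>.
  Constant curves are the case \<open>v = 0\<close>.
\<close>

definition minimal_geodesic :: "real \<Rightarrow> real \<Rightarrow> (real \<Rightarrow> 'a::real_inner) \<Rightarrow> bool" where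
  "minimal_geodesic a b \<gamma> \<longleftrightarrow> a \<le> b \<and>
     (\<exists>p w v. norm p = 1 \<and> norm w = 1 \<and> p \<bullet> w = 0 \<and> 0 \<le> v \<and>
        (\<forall>t\<in>{a..b}. \<gamma> t = cos (v * (t - a)) *\<^sub>R p + sin (v * (t - a)) *\<^sub>R w) \<and>
        v * (b - a) = sphere_dist (\<gamma> a) (\<gamma> b))"

definition spherically_convex :: "'a::real_inner set \<Rightarrow> bool" where
  "spherically_convex C \<longleftrightarrow> C \<subseteq> sphere 0 1 \<and>
     (\<forall>x\<in>C. \<forall>y\<in>C. \<forall>a b \<gamma>.
        minimal_geodesic a b \<gamma> \<and> \<gamma> a = x \<and> \<gamma> b = y \<longrightarrow> \<gamma> ` {a..b} \<subseteq> C)"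

text \<open>
  As with \<^const>\<open>convex_on\<close>, convexity of the domain is part of the predicate.
\<close>

definition spherically_quasiconvex_on ::
  "'a::real_inner set \<Rightarrow> ('a \<Rightarrow> real) \<Rightarrow> bool" where
  "spherically_quasiconvex_on C f \<longleftrightarrow> spherically_convex C \<and>
     (\<forall>a b \<gamma>. minimal_geodesic a b \<gamma> \<and> \<gamma> ` {a..b} \<subseteq> C \<longrightarrow>
        (\<forall>t1 t2 t. a \<le> t1 \<and> t1 \<le> t \<and> t \<le> t2 \<and> t2 \<le> b \<longrightarrow>
           f (\<gamma> t) \<le> max (f (\<gamma> t1)) (f (\<gamma> t2))))"

end

theory Submission
  imports Defs
begin

text \<open>
  Subduality keeps all angles between points of \<open>K\<close> at most \<open>\<pi>/2\<close>, so the points of the minimal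
  geodesic from \<open>x\<close> to \<open>y\<close> are exactly the unit vectors \<open>\<alpha> x + \<beta> y\<close> with \<open>\<alpha>, \<beta> \<ge> 0\<close>.  Hence spherical
  quasi-convexity says that the Rayleigh quotient at \<open>x + y\<close> is at most the maximum of its values at
  \<open>x\<close> and \<open>y\<close>, for \<open>x, y\<close> in the interior of \<open>K\<close>.  By continuity this extends to all nonzero \<open>x, y\<close> in \<open>K\<close>,
  where it expresses convexity of all its sublevel cones.
\<close>

section \<open>Cones under strictly positive scaling\<close>

lemma pos_cone_scaleR: "pos_cone K \<Longrightarrow> x \<in> K \<Longrightarrow> 0 < c \<Longrightarrow> c *\<^sub>R x \<in> K"
  by (simp add: pos_cone_def)

lemma pos_cone_interior:
  fixes K :: "'a::real_normed_vector set"
  assumes "pos_cone K"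
  shows "pos_cone (interior K)"
  unfolding pos_cone_def
proof (intro ballI allI impI)
  fix x and c :: real
  assume x: "x \<in> interior K" and c: "0 < c"
  have "(*\<^sub>R) c ` interior K \<subseteq> interior K"
  proof (rule interior_maximal)
    show "(*\<^sub>R) c ` interior K \<subseteq> K"
      using assms c interior_subset by (blast intro: pos_cone_scaleR)
    show "open ((*\<^sub>R) c ` interior K)"
      using c by (intro open_scaling) auto
  qed
  with x show "c *\<^sub>R x \<in> interior K" by blast
qed

lemma pos_cone_convex_add:
  assumes "pos_cone K" "convex K" "x \<in> K" "y \<in> K"
  shows "x + y \<in> K"
proof -
  have "(1/2) *\<^sub>R x + (1/2) *\<^sub>R y \<in> K"
    using assms by (intro convexD) auto
  then have "2 *\<^sub>R ((1/2) *\<^sub>R x + (1/2) *\<^sub>R y) \<in> K"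
    using assms(1) by (intro pos_cone_scaleR) auto
  then show ?thesis by (simp add: scaleR_add_right)
qed

text \<open>A \<open>pos_cone\<close> need not contain 0, so the combination with both coefficients
  zero has to be excluded; every other case reduces to scaling and addition.\<close>

lemma pos_cone_convex_combination:
  assumes K: "pos_cone K" "convex K" "x \<in> K" "y \<in> K"
    and ab: "0 \<le> \<alpha>" "0 \<le> \<beta>" "\<alpha> *\<^sub>R x + \<beta> *\<^sub>R y \<noteq> 0"
  shows "\<alpha> *\<^sub>R x + \<beta> *\<^sub>R y \<in> K"
proof -
  consider "\<alpha> = 0" "\<beta> > 0" | "\<alpha> > 0" "\<beta> = 0" | "\<alpha> > 0" "\<beta> > 0"
    using ab by fastforce
  then show ?thesis
    by cases (use K in \<open>auto intro!: pos_cone_scaleR pos_cone_convex_add\<close>)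
qed

section \<open>Minimal geodesics as nonnegative combinations\<close>

lemma minimal_geodesic_norm:
  assumes "minimal_geodesic a b \<gamma>" "t \<in> {a..b}"
  shows "norm (\<gamma> t) = 1"
proof -
  obtain p w v where pw: "norm p = 1" "norm w = 1" "p \<bullet> w = 0"
    and g: "\<gamma> t = cos (v * (t - a)) *\<^sub>R p + sin (v * (t - a)) *\<^sub>R w"
    using assms unfolding minimal_geodesic_def by blast
  have "p \<bullet> p = 1" "w \<bullet> w = 1" using pw by (simp_all add: norm_eq_1)
  then have "\<gamma> t \<bullet> \<gamma> t = (cos (v * (t - a)))\<^sup>2 + (sin (v * (t - a)))\<^sup>2"
    using pw(3) unfolding g
    by (simp add: inner_add_left inner_add_right inner_commute power2_eq_square)
  then show ?thesis by (simp add: norm_eq_1)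
qed

text \<open>This is spherical linear interpolation: the coefficients are the sines of
  \<open>v * (t2 - t)\<close> and \<open>v * (t - t1)\<close> divided by that of
  \<open>v * (t2 - t1)\<close>. An angle of at most pi/2 between the endpoints keeps all these arcs
  below pi, so no sine is negative.\<close>

lemma minimal_geodesic_combination:
  assumes geo: "minimal_geodesic a b \<gamma>" and acute: "0 \<le> \<gamma> a \<bullet> \<gamma> b"
    and t: "a \<le> t1" "t1 \<le> t" "t \<le> t2" "t2 \<le> b"
  shows "\<exists>\<alpha>\<ge>0. \<exists>\<beta>\<ge>0. \<gamma> t = \<alpha> *\<^sub>R \<gamma> t1 + \<beta> *\<^sub>R \<gamma> t2"
proof -
  obtain p w v where v: "0 \<le> v"
    and g: "\<And>t. t \<in> {a..b} \<Longrightarrow> \<gamma> t = cos (v * (t - a)) *\<^sub>R p + sin (v * (t - a)) *\<^sub>R w"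
    and len: "v * (b - a) = sphere_dist (\<gamma> a) (\<gamma> b)"
    using geo unfolding minimal_geodesic_def by blast
  have "\<bar>\<gamma> a \<bullet> \<gamma> b\<bar> \<le> 1"
    using Cauchy_Schwarz_ineq2[of "\<gamma> a" "\<gamma> b"] minimal_geodesic_norm[OF geo] t by simp
  then have "v * (b - a) \<le> pi / 2"
    unfolding len sphere_dist_def using acute by (intro arccos_le_pi2) auto
  moreover have "v * (t2 - t1) \<le> v * (b - a)"
    using v t by (intro mult_left_mono) auto
  ultimately have small: "v * (t2 - t1) < pi" using pi_gt_zero by linarith
  have le: "v * (t2 - t) \<le> v * (t2 - t1)" "v * (t - t1) \<le> v * (t2 - t1)"
    using v t by (auto intro!: mult_left_mono)
  have nonneg: "0 \<le> v * (t2 - t)" "0 \<le> v * (t - t1)" using v t by auto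
  have key: "sin (v * (t2 - t1)) *\<^sub>R \<gamma> t = sin (v * (t2 - t)) *\<^sub>R \<gamma> t1 + sin (v * (t - t1)) *\<^sub>R \<gamma> t2"
  proof -
    define A B C where "A = v * (t1 - a)" and "B = v * (t - a)" and "C = v * (t2 - a)"
    have eq: "v * (t2 - t1) = C - A" "v * (t2 - t) = C - B" "v * (t - t1) = B - A"
      by (simp_all add: A_def B_def C_def algebra_simps)
    \<comment> \<open>The coordinates of \<open>key\<close> along \<open>p\<close> and
      \<open>w\<close>: real and imaginary part of sin(C-A) e^(iB) = sin(C-B) e^(iA) + sin(B-A)
      e^(iC).\<close>
    have 1: "sin (C - A) * cos B = sin (C - B) * cos A + sin (B - A) * cos C"
      by (simp add: sin_diff algebra_simps)
    have 2: "sin (C - A) * sin B = sin (C - B) * sin A + sin (B - A) * sin C"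
      by (simp add: sin_diff algebra_simps)
    have "\<gamma> t1 = cos A *\<^sub>R p + sin A *\<^sub>R w" "\<gamma> t = cos B *\<^sub>R p + sin B *\<^sub>R w"
      "\<gamma> t2 = cos C *\<^sub>R p + sin C *\<^sub>R w"
      using g t by (auto simp: A_def B_def C_def)
    then show ?thesis
      unfolding eq using 1 2
      by (simp add: scaleR_add_right) (simp add: algebra_simps flip: scaleR_add_left)
  qed
  show ?thesis
  proof (cases "v * (t2 - t1) = 0")
    case True
    \<comment> \<open>Here the denominator vanishes: either the curve is constant, or
      \<open>t1 = t2\<close> squeezes \<open>t\<close>.\<close>
    then have "v = 0 \<or> t = t1" using t by auto
    then have "\<gamma> t = 1 *\<^sub>R \<gamma> t1 + 0 *\<^sub>R \<gamma> t2" using g t by auto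
    then show ?thesis by (metis order_refl zero_le_one)
  next
    case False
    with v t have "0 < v * (t2 - t1)" by (simp add: less_le)
    then have pos: "0 < sin (v * (t2 - t1))" using small by (rule sin_gt_zero)
    let ?s = "inverse (sin (v * (t2 - t1)))"
    have "\<gamma> t = ?s *\<^sub>R (sin (v * (t2 - t1)) *\<^sub>R \<gamma> t)" using pos by simp
    then have "\<gamma> t = (?s * sin (v * (t2 - t))) *\<^sub>R \<gamma> t1 + (?s * sin (v * (t - t1))) *\<^sub>R \<gamma> t2"
      unfolding key by (simp add: scaleR_add_right)
    moreover have "0 \<le> ?s * sin (v * (t2 - t))" "0 \<le> ?s * sin (v * (t - t1))"
      using pos le nonneg small by (auto intro!: mult_nonneg_nonneg sin_ge_zero)
    ultimately show ?thesis by blast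
  qed
qed

text \<open>Gram-Schmidt turns \<open>x\<close>, \<open>y\<close> into an orthonormal pair
  \<open>x\<close>, \<open>w\<close>, and the unit-speed arc from \<open>x\<close> towards
  \<open>w\<close> reaches \<open>y\<close> at \<open>arccos (x \<bullet> y)\<close>. The given
  combination is the point at parameter \<open>arccos k\<close>, where \<open>k\<close> is its
  coordinate along \<open>x\<close>; it remains to see that this parameter does not pass
  \<open>b\<close>.\<close>

lemma minimal_geodesic_through:
  fixes x y :: "'a::real_inner"
  assumes x: "norm x = 1" and y: "norm y = 1" and ne: "x \<noteq> y" and acute: "0 \<le> x \<bullet> y"
    and ab: "0 \<le> \<alpha>" "0 \<le> \<beta>" and z: "norm (\<alpha> *\<^sub>R x + \<beta> *\<^sub>R y) = 1"
  shows "\<exists>\<gamma> b t. minimal_geodesic 0 b \<gamma> \<and> \<gamma> 0 = x \<and> \<gamma> b = y \<and> t \<in> {0..b} \<and>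
    \<gamma> t = \<alpha> *\<^sub>R x + \<beta> *\<^sub>R y"
proof -
  define s where "s = x \<bullet> y"
  have xx: "x \<bullet> x = 1" and yy: "y \<bullet> y = 1" using x y by (simp_all add: norm_eq_1)
  have "s \<le> 1" using norm_cauchy_schwarz[of x y] x y by (simp add: s_def)
  moreover have "s \<noteq> 1"
    using ne x y norm_cauchy_schwarz_eq[of x y] by (auto simp: s_def)
  ultimately have s: "0 \<le> s" "s < 1" using acute by (auto simp: s_def)
  define r where "r = sqrt (1 - s\<^sup>2)"
  have "s\<^sup>2 < 1" using s by (simp add: abs_square_less_1)
  then have r: "0 < r" "r\<^sup>2 = 1 - s\<^sup>2" by (auto simp: r_def)
  \<comment> \<open>\<open>s\<close> and \<open>r\<close> are the cosine and sine of the angle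
    between \<open>x\<close> and \<open>y\<close>; \<open>r\<close> is positive because
    \<open>x\<close> and \<open>y\<close> are distinct unit vectors at an angle of at most
    pi/2.\<close>
  define w where "w = inverse r *\<^sub>R (y - s *\<^sub>R x)"
  have y_eq: "y = s *\<^sub>R x + r *\<^sub>R w" using r by (simp add: w_def)
  have xw: "x \<bullet> w = 0" by (simp add: w_def inner_diff_right xx s_def)
  have "(y - s *\<^sub>R x) \<bullet> (y - s *\<^sub>R x) = r\<^sup>2"
    unfolding r(2)
    by (simp add: inner_diff_left inner_diff_right xx yy s_def inner_commute power2_eq_square)
  then have ww: "w \<bullet> w = 1"
    using r(1) by (simp add: w_def power2_eq_square flip: mult.assoc)
  define \<gamma> where "\<gamma> t = cos t *\<^sub>R x + sin t *\<^sub>R w" for t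
  define b where "b = arccos s"
  have g0: "\<gamma> 0 = x" by (simp add: \<gamma>_def)
  have gb: "\<gamma> b = y"
    using s by (subst y_eq) (simp add: \<gamma>_def b_def cos_arccos sin_arccos r_def)
  have b0: "0 \<le> b" using s by (simp add: b_def arccos_lbound)
  have "norm w = 1" using ww by (simp add: norm_eq_1)
  then have geo: "minimal_geodesic 0 b \<gamma>"
    unfolding minimal_geodesic_def
  proof (intro conjI exI ballI)
    show "1 * (b - 0) = sphere_dist (\<gamma> 0) (\<gamma> b)"
      unfolding g0 gb by (simp add: sphere_dist_def b_def s_def)
  qed (use b0 x xw in \<open>auto simp: \<gamma>_def\<close>)
  define k where "k = \<alpha> + \<beta> * s"
  define m where "m = \<beta> * r"
  have zk: "\<alpha> *\<^sub>R x + \<beta> *\<^sub>R y = k *\<^sub>R x + m *\<^sub>R w"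
    by (subst y_eq) (simp add: k_def m_def algebra_simps)
  have km: "k\<^sup>2 + m\<^sup>2 = 1"
    using z unfolding zk norm_eq_1
    by (simp add: inner_add_left inner_add_right xx ww xw inner_commute[of w x] power2_eq_square)
  have k0: "0 \<le> k" and m0: "0 \<le> m" using ab s r by (auto simp: k_def m_def)
  have k1: "k \<le> 1" using km by (metis le_add_same_cancel1 one_power2 power2_le_imp_le zero_le_one zero_le_power2)
  \<comment> \<open>The unit vector lies on or beyond the chord from \<open>x\<close> to
    \<open>y\<close>. Together with \<open>s < 1\<close> this gives \<open>s \<le> k\<close>, that
    is, \<open>arccos k \<le> b\<close>.\<close>
  have "1 \<le> \<alpha> + \<beta>"
    using norm_triangle_ineq[of "\<alpha> *\<^sub>R x" "\<beta> *\<^sub>R y"] z ab x y by simp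
  then have "s \<le> s * (\<alpha> + \<beta>)" using s by (simp add: mult_le_cancel_left1)
  also have "\<dots> \<le> k"
    using s ab by (simp add: k_def algebra_simps mult_left_le_one_le mult_left_le)
  finally have "s \<le> k" .
  then have "arccos k \<in> {0..b}"
    using s k0 k1 by (auto simp: b_def arccos_lbound intro!: arccos_le_arccos)
  moreover have "sin (arccos k) = m"
  proof -
    have "1 - k\<^sup>2 = m\<^sup>2" using km by simp
    then show ?thesis using k0 k1 m0 by (simp add: sin_arccos)
  qed
  then have "\<gamma> (arccos k) = \<alpha> *\<^sub>R x + \<beta> *\<^sub>R y"
    using k0 k1 by (simp add: zk \<gamma>_def cos_arccos)
  ultimately show ?thesis using geo g0 gb by blast
qed

section \<open>Spherical convexity and quasi-convexity via nonnegative combinations\<close>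

lemma spherically_convex_cone:
  fixes K :: "'a::real_inner set"
  assumes K: "pos_cone K" "convex K" and acute: "\<And>x y. x \<in> K \<Longrightarrow> y \<in> K \<Longrightarrow> 0 \<le> x \<bullet> y"
  shows "spherically_convex (sphere 0 1 \<inter> K)"
  unfolding spherically_convex_def
proof (intro conjI ballI allI impI image_subsetI)
  fix x y a b and \<gamma> :: "real \<Rightarrow> 'a" and t
  assume xy: "x \<in> sphere 0 1 \<inter> K" "y \<in> sphere 0 1 \<inter> K"
    and g: "minimal_geodesic a b \<gamma> \<and> \<gamma> a = x \<and> \<gamma> b = y" and t: "t \<in> {a..b}"
  then obtain \<alpha> \<beta> where "0 \<le> \<alpha>" "0 \<le> \<beta>" "\<gamma> t = \<alpha> *\<^sub>R x + \<beta> *\<^sub>R y"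
    using minimal_geodesic_combination[of a b \<gamma> a t b] acute by auto
  moreover have "norm (\<gamma> t) = 1" using g t minimal_geodesic_norm by blast
  ultimately show "\<gamma> t \<in> sphere 0 1 \<inter> K"
    using pos_cone_convex_combination[OF K, of x y \<alpha> \<beta>] xy
    by (metis Int_iff mem_sphere_0 norm_zero zero_neq_one)
qed auto

lemma spherically_quasiconvex_on_combination:
  assumes f: "spherically_quasiconvex_on C f" and x: "x \<in> C" and y: "y \<in> C"
    and acute: "0 \<le> x \<bullet> y" and ab: "0 \<le> \<alpha>" "0 \<le> \<beta>"
    and z: "norm (\<alpha> *\<^sub>R x + \<beta> *\<^sub>R y) = 1"
  shows "f (\<alpha> *\<^sub>R x + \<beta> *\<^sub>R y) \<le> max (f x) (f y)"
proof -
  have sc: "spherically_convex C" using f by (simp add: spherically_quasiconvex_on_def)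
  then have n: "norm x = 1" "norm y = 1" using x y by (auto simp: spherically_convex_def)
  show ?thesis
  proof (cases "x = y")
    case True
    \<comment> \<open>Equal endpoints span no plane for an arc; the only unit vector among the
      combinations is then \<open>x\<close> itself.\<close>
    then have "\<alpha> *\<^sub>R x + \<beta> *\<^sub>R y = (\<alpha> + \<beta>) *\<^sub>R x" by (simp add: scaleR_add_left)
    moreover from this have "\<alpha> + \<beta> = 1" using z n ab by simp
    ultimately show ?thesis by simp
  next
    case False
    obtain \<gamma> b t where g: "minimal_geodesic 0 b \<gamma>" "\<gamma> 0 = x" "\<gamma> b = y" "t \<in> {0..b}"
      "\<gamma> t = \<alpha> *\<^sub>R x + \<beta> *\<^sub>R y"
      using minimal_geodesic_through[OF n False acute ab z] by blast
    have "\<gamma> ` {0..b} \<subseteq> C" using sc g x y unfolding spherically_convex_def by blast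
    then have "f (\<gamma> t) \<le> max (f (\<gamma> 0)) (f (\<gamma> b))"
      using f g(1,4) unfolding spherically_quasiconvex_on_def by (meson atLeastAtMost_iff order_refl)
    then show ?thesis using g by simp
  qed
qed

section \<open>Rayleigh quotients and convexity of sublevel cones\<close>

text \<open>By homogeneity the quotient is \<open>q\<close> at the normalised vector, so
  quasi-convexity gives the bound in the interior. Boundary points are reached by pushing
  \<open>x\<close> and \<open>y\<close> along an interior direction \<open>e\<close> and letting the
  shift tend to 0.\<close>

lemma rayleigh_quotient_add_le:
  fixes K :: "'a::euclidean_space set" and q :: "'a \<Rightarrow> real"
  assumes K: "pos_cone K" "convex K" "interior K \<noteq> {}"
    and acute: "\<And>x y. x \<in> K \<Longrightarrow> y \<in> K \<Longrightarrow> 0 \<le> x \<bullet> y"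
    and hom: "\<And>c x. q (c *\<^sub>R x) = c\<^sup>2 * q x" and cont: "continuous_on UNIV q"
    and qc: "spherically_quasiconvex_on (sphere 0 1 \<inter> interior K) q"
    and x: "x \<in> K" "x \<noteq> 0" and y: "y \<in> K" "y \<noteq> 0"
  shows "q (x + y) / (norm (x + y))\<^sup>2 \<le> max (q x / (norm x)\<^sup>2) (q y / (norm y)\<^sup>2)"
proof -
  define R where "R x = q x / (norm x)\<^sup>2" for x
  have R_sgn: "R x = q (sgn x)" for x
    by (simp add: R_def sgn_div_norm hom power_inverse divide_inverse)
  have shift_ne0: "u + c *\<^sub>R e \<noteq> 0" if "u \<in> K" "u \<noteq> 0" "e \<in> K" "0 \<le> c" for u e :: 'a and c
  proof
    assume "u + c *\<^sub>R e = 0"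
    \<comment> \<open>Pairing with \<open>u\<close> works because \<open>acute\<close> makes the
      second summand nonnegative.\<close>
    then have "u \<bullet> u + c * (u \<bullet> e) = 0" by (metis inner_add_right inner_scaleR_right inner_zero_right)
    moreover have "0 < u \<bullet> u" "0 \<le> c * (u \<bullet> e)" using that acute by auto
    ultimately show False by linarith
  qed
  have interior_le: "R (u + v) \<le> max (R u) (R v)"
    if uv: "u \<in> interior K" "v \<in> interior K" "u \<noteq> 0" "v \<noteq> 0" for u v
  proof -
    have uvK: "u \<in> K" "v \<in> K" using uv interior_subset by auto
    have ne: "u + v \<noteq> 0" using shift_ne0[of u v 1] uvK uv by simp
    have sgn_in: "sgn u \<in> sphere 0 1 \<inter> interior K" "sgn v \<in> sphere 0 1 \<inter> interior K"
      using uv pos_cone_interior[OF K(1)]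
      by (auto simp: norm_sgn sgn_div_norm intro!: pos_cone_scaleR)
    have sgn_eq: "sgn (u + v) =
        (norm u / norm (u + v)) *\<^sub>R sgn u + (norm v / norm (u + v)) *\<^sub>R sgn v"
      using uv by (simp add: sgn_div_norm scaleR_add_right field_simps)
    have "0 \<le> sgn u \<bullet> sgn v" using acute sgn_in interior_subset by blast
    then have "q (sgn (u + v)) \<le> max (q (sgn u)) (q (sgn v))"
      unfolding sgn_eq using ne norm_sgn[of "u + v"] sgn_in
      by (intro spherically_quasiconvex_on_combination[OF qc]) (simp_all flip: sgn_eq)
    then show ?thesis by (simp add: R_sgn)
  qed
  obtain e where e: "e \<in> interior K" using K(3) by blast
  then have eK: "e \<in> K" using interior_subset by blast
  have shift_interior: "u + c *\<^sub>R e \<in> interior K" if "u \<in> K" "0 < c" for u c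
  proof -
    have "2 *\<^sub>R u \<in> K" "(2 * c) *\<^sub>R e \<in> interior K"
      using that e K(1) pos_cone_interior[OF K(1)] by (auto intro!: pos_cone_scaleR)
    \<comment> \<open>The shifted point is the midpoint of a point of \<open>K\<close> and an
      interior point, hence interior by convexity.\<close>
    then have "2 *\<^sub>R u - (1/2) *\<^sub>R (2 *\<^sub>R u - (2 * c) *\<^sub>R e) \<in> interior K"
      using K(2) by (intro mem_interior_convex_shrink) auto
    moreover have "2 *\<^sub>R u - (1/2) *\<^sub>R (2 *\<^sub>R u - (2 * c) *\<^sub>R e) = u + c *\<^sub>R e"
      by (simp add: scaleR_diff_right scaleR_2)
    ultimately show ?thesis by simp
  qed
  have lim: "((\<lambda>c. R (u + c *\<^sub>R d)) \<longlongrightarrow> R u) (at_right 0)" if "u \<noteq> 0" for u d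
  proof -
    have "isCont q u" using cont by (simp add: continuous_on_eq_continuous_at)
    then have "isCont R u" unfolding R_def using that by (intro continuous_intros) auto
    moreover have "((\<lambda>c. u + c *\<^sub>R d) \<longlongrightarrow> u + 0 *\<^sub>R d) (at_right 0)" by (intro tendsto_intros)
    ultimately show ?thesis by (auto intro: isCont_tendsto_compose)
  qed
  have xy: "x + y \<noteq> 0" using shift_ne0[of x y 1] x y by simp
  have "R (x + y) \<le> max (R x) (R y)"
  \<comment> \<open>Shifting both \<open>x\<close> and \<open>y\<close> by
    \<open>c *\<^sub>R e\<close> moves their sum along \<open>2 *\<^sub>R e\<close>; all three
    quotients converge as \<open>c\<close> decreases to 0, since their base points are
    nonzero.\<close>
  proof (rule tendsto_le[OF trivial_limit_at_right_real tendsto_max[OF lim[of x e] lim[of y e]]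
        lim[of "x + y" "2 *\<^sub>R e"]])
    show "\<forall>\<^sub>F c in at_right 0. R (x + y + c *\<^sub>R 2 *\<^sub>R e) \<le> max (R (x + c *\<^sub>R e)) (R (y + c *\<^sub>R e))"
      using eventually_at_right_less
    proof eventually_elim
      case (elim c)
      have "x + y + c *\<^sub>R 2 *\<^sub>R e = (x + c *\<^sub>R e) + (y + c *\<^sub>R e)"
        by (simp only: scaleR_2 scaleR_add_right add_ac)
      moreover have "R ((x + c *\<^sub>R e) + (y + c *\<^sub>R e)) \<le> max (R (x + c *\<^sub>R e)) (R (y + c *\<^sub>R e))"
        using elim x y eK by (intro interior_le shift_interior shift_ne0) auto
      ultimately show ?case by (simp only:)
    qed
  qed (use x y xy in auto)
  then show ?thesis by (simp add: R_def)
qed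

text \<open>Sublevel sets of the Rayleigh quotient are cones, so their convexity amounts to closure
  under addition, which is the preceding inequality. Conversely, a point of a geodesic is a
  nonnegative combination of any two points surrounding it, so it stays in each convex sublevel cone
  containing those two.\<close>

theorem spherically_quasiconvex_on_iff_convex_sublevel:
  fixes K :: "'a::euclidean_space set" and q :: "'a \<Rightarrow> real"
  assumes K: "pos_cone K" "convex K" "interior K \<noteq> {}"
    and acute: "\<And>x y. x \<in> K \<Longrightarrow> y \<in> K \<Longrightarrow> 0 \<le> x \<bullet> y"
    and hom: "\<And>c x. q (c *\<^sub>R x) = c\<^sup>2 * q x" and cont: "continuous_on UNIV q"
  shows "spherically_quasiconvex_on (sphere 0 1 \<inter> interior K) q \<longleftrightarrow>
    (\<forall>c. convex {x \<in> K. q x \<le> c * (norm x)\<^sup>2})"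
proof (intro iffI allI)
  fix c
  assume qc: "spherically_quasiconvex_on (sphere 0 1 \<inter> interior K) q"
  let ?S = "{x \<in> K. q x \<le> c * (norm x)\<^sup>2}"
  have cone: "pos_cone ?S"
    using K(1) by (auto simp: pos_cone_def hom power_mult_distrib intro: mult_left_mono)
  have add: "x + y \<in> ?S" if "x \<in> ?S" "y \<in> ?S" for x y
  \<comment> \<open>The Rayleigh quotient carries no information at 0, so zero summands are split
    off.\<close>
  proof (cases "x = 0 \<or> y = 0")
    case True
    then show ?thesis using that by auto
  next
    case False
    have "x + y \<in> K" using that K by (auto intro: pos_cone_convex_add)
    moreover have "q (x + y) \<le> c * (norm (x + y))\<^sup>2"
    proof (cases "x + y = 0")
      case True
      then show ?thesis using hom[of 0 0] by simp
    next
      case ne: False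
      have "q (x + y) / (norm (x + y))\<^sup>2 \<le> max (q x / (norm x)\<^sup>2) (q y / (norm y)\<^sup>2)"
        using rayleigh_quotient_add_le[OF K acute hom cont qc, of x y] that False by auto
      also have "\<dots> \<le> c" using that False by (simp add: divide_simps)
      finally show ?thesis using ne by (simp add: divide_simps)
    qed
    ultimately show ?thesis by simp
  qed
  show "convex ?S"
  proof (rule convexI)
    fix x y :: 'a and u v :: real
    assume xy: "x \<in> ?S" "y \<in> ?S" and uv: "0 \<le> u" "0 \<le> v" "u + v = 1"
    \<comment> \<open>\<open>pos_cone\<close> allows only positive factors, so zero weights are
      treated apart.\<close>
    consider "u = 0" "v = 1" | "u = 1" "v = 0" | "0 < u" "0 < v"
      using uv by fastforce
    then show "u *\<^sub>R x + v *\<^sub>R y \<in> ?S"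
    proof cases
      case 3
      then show ?thesis using xy cone by (intro add pos_cone_scaleR)
    qed (use xy in auto)
  qed
next
  assume cvx: "\<forall>c. convex {x \<in> K. q x \<le> c * (norm x)\<^sup>2}"
  have acute': "0 \<le> x \<bullet> y" if "x \<in> interior K" "y \<in> interior K" for x y
    using that acute interior_subset by blast
  have "spherically_convex (sphere 0 1 \<inter> interior K)"
    using K(1,2) acute' by (intro spherically_convex_cone pos_cone_interior convex_interior)
  moreover have "q (\<gamma> t) \<le> max (q (\<gamma> t1)) (q (\<gamma> t2))"
    if g: "minimal_geodesic a b \<gamma>" "\<gamma> ` {a..b} \<subseteq> sphere 0 1 \<inter> interior K"
      and t: "a \<le> t1" "t1 \<le> t" "t \<le> t2" "t2 \<le> b" for a b \<gamma> t1 t2 t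
  proof -
    \<comment> \<open>On unit vectors the sublevel condition reads \<open>q x \<le> c\<close>; this
      is the least level whose cone contains both \<open>\<gamma> t1\<close> and
      \<open>\<gamma> t2\<close>.\<close>
    define c where "c = max (q (\<gamma> t1)) (q (\<gamma> t2))"
    let ?S = "{x \<in> K. q x \<le> c * (norm x)\<^sup>2}"
    have gin: "\<gamma> u \<in> K" "norm (\<gamma> u) = 1" if "u \<in> {a..b}" for u
      using g(2) that interior_subset[of K] by (auto simp: image_subset_iff)
    have "0 \<le> \<gamma> a \<bullet> \<gamma> b" using acute gin t by simp
    then obtain \<alpha> \<beta> where ab: "0 \<le> \<alpha>" "0 \<le> \<beta>" "\<gamma> t = \<alpha> *\<^sub>R \<gamma> t1 + \<beta> *\<^sub>R \<gamma> t2"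
      using minimal_geodesic_combination[OF g(1) _ t] by blast
    have nt: "norm (\<gamma> t) = 1" using gin t by simp
    have "pos_cone ?S"
      using K(1) by (auto simp: pos_cone_def hom power_mult_distrib intro: mult_left_mono)
    moreover have "\<gamma> t1 \<in> ?S" "\<gamma> t2 \<in> ?S" using gin t by (auto simp: c_def)
    moreover have "\<alpha> *\<^sub>R \<gamma> t1 + \<beta> *\<^sub>R \<gamma> t2 \<noteq> 0" using nt by (auto simp flip: ab(3))
    ultimately have "\<gamma> t \<in> ?S"
      unfolding ab(3) using cvx ab(1,2) by (intro pos_cone_convex_combination) auto
    then show ?thesis using nt by (simp add: c_def)
  qed
  ultimately show "spherically_quasiconvex_on (sphere 0 1 \<inter> interior K) q"
    unfolding spherically_quasiconvex_on_def by blast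
qed

theorem corollary2:
  fixes K :: "(real ^ 'n) set" and A :: "real ^ 'n ^ 'n"
  assumes "proper_cone K" and "subdual K" and "A = transpose A"
  shows "spherically_quasiconvex_on (sphere 0 1 \<inter> interior K) (\<lambda>x. (A *v x) \<bullet> x) \<longleftrightarrow>
    (\<forall>c::real. convex {x \<in> K. ((A - c *\<^sub>R mat 1) *v x) \<bullet> x \<le> 0})"
proof -
  have K: "pos_cone K" "convex K" "interior K \<noteq> {}"
    using assms(1) by (auto simp: proper_cone_def)
  have acute: "0 \<le> x \<bullet> y" if "x \<in> K" "y \<in> K" for x y
    using assms(2) that by (auto simp: subdual_def dual_cone_def)
  \<comment> \<open>Subtracting \<open>c\<close> times the identity lowers the quadratic form by
    \<open>c * (norm x)\<^sup>2\<close>, so the cones in question are the sublevel cones of the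
    Rayleigh quotient of \<open>A\<close>.\<close>
  have shift: "((A - c *\<^sub>R mat 1) *v x) \<bullet> x \<le> 0 \<longleftrightarrow> (A *v x) \<bullet> x \<le> c * (norm x)\<^sup>2" for c x
    by (simp add: matrix_vector_mult_diff_rdistrib scaleR_matrix_vector_assoc[symmetric]
        inner_diff_left power2_norm_eq_inner)
  show ?thesis
    unfolding shift
    by (rule spherically_quasiconvex_on_iff_convex_sublevel[OF K acute])
      (auto simp: matrix_vector_mult_scaleR power2_eq_square
        intro!: continuous_intros matrix_vector_mult_linear_continuous_on)
qed

end
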